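(* Let $\mu>0$ and let $X$ be a Poisson random variable with mean $\mu$. Then $X$ is strictly $q$-subweibull for every $q\in(0,1]$, but $X$ is not $q$-subweibull for any $q>1$.
   Context: For $q>0$, a real random variable $X$ is $q$-subweibull if $\mathbb{E}[\exp(\lambda^q|X|^q)]<\infty$ for some $\lambda>0$; it is strictly $q$-subweibull if this holds for all $\lambda>0$. *)

theory Defs
  imports "HOL-Probability.Probability"
begin

text \<open>
  The expectation of the nonnegative variable \<open>exp (\<lambda>^q \<bar>X\<bar>^q)\<close> is taken in \<open>[0, \<infinity>]\<close>, so that its
  finiteness is a genuine condition (the Bochner integral of a non-integrable function is 0).
  Both notions are meant for \<open>q > 0\<close>; then \<open>0 powr q = 0\<close> is the usual value.
\<close>

definition subweibull :: "'a measure \<Rightarrow> real \<Rightarrow> ('a \<Rightarrow> real) \<Rightarrow> bool" where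
  "subweibull M q X \<longleftrightarrow>
     (\<exists>l>0. (\<integral>\<^sup>+ \<omega>. ennreal (exp (l powr q * \<bar>X \<omega>\<bar> powr q)) \<partial>M) < \<infinity>)"

definition strictly_subweibull :: "'a measure \<Rightarrow> real \<Rightarrow> ('a \<Rightarrow> real) \<Rightarrow> bool" where
  "strictly_subweibull M q X \<longleftrightarrow>
     (\<forall>l>0. (\<integral>\<^sup>+ \<omega>. ennreal (exp (l powr q * \<bar>X \<omega>\<bar> powr q)) \<partial>M) < \<infinity>)"

text \<open>
  A real random variable is Poisson with mean \<open>\<mu>\<close> if its law is the Poisson distribution of rate
  \<open>\<mu>\<close>, transported from the naturals to the reals. Since \<open>poisson_pmf\<close> is specified only for a
  positive rate, this is meaningful for \<open>\<mu> > 0\<close> only.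
\<close>

definition poisson_rv :: "'a measure \<Rightarrow> real \<Rightarrow> ('a \<Rightarrow> real) \<Rightarrow> bool" where
  "poisson_rv M \<mu> X \<longleftrightarrow>
     X \<in> borel_measurable M \<and> distr M borel X = distr (measure_pmf (poisson_pmf \<mu>)) borel real"

end

theory Submission
  imports Defs "HOL-Real_Asymp.Real_Asymp"
begin

text \<open>
  Everything reduces to the series with terms \<open>\<mu>\<^sup>k / k! \<cdot> exp (\<lambda>\<^sup>q k\<^sup>q)\<close>. For \<open>q \<le> 1\<close> the bound
  \<open>(\<lambda>k)\<^sup>q \<le> 1 + \<lambda>k\<close> dominates it by an exponential series. For \<open>q > 1\<close> we have \<open>k! \<le> k\<^sup>k\<close>,
  and \<open>k\<^sup>q\<close> outgrows \<open>k ln k\<close>, so the terms do not even tend to zero.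
\<close>

lemma nn_integral_poisson_rv:
  assumes "poisson_rv M \<mu> X" and "f \<in> borel_measurable borel"
  shows "(\<integral>\<^sup>+ \<omega>. f (X \<omega>) \<partial>M) = (\<integral>\<^sup>+ k. f (real k) \<partial>measure_pmf (poisson_pmf \<mu>))"
proof -
  have "(\<integral>\<^sup>+ \<omega>. f (X \<omega>) \<partial>M) = (\<integral>\<^sup>+ x. f x \<partial>distr M borel X)"
    using assms by (intro nn_integral_distr[symmetric]) (auto simp: poisson_rv_def)
  also have "\<dots> = (\<integral>\<^sup>+ x. f x \<partial>distr (measure_pmf (poisson_pmf \<mu>)) borel real)"
    using assms(1) by (simp add: poisson_rv_def)
  also have "\<dots> = (\<integral>\<^sup>+ k. f (real k) \<partial>measure_pmf (poisson_pmf \<mu>))"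
    using assms(2) by (simp add: nn_integral_distr)
  finally show ?thesis .
qed

text \<open>Integrating against the pmf gives a series of extended nonnegative reals. Since all
  terms are finite and nonnegative, its sum is finite exactly when the real series
  converges.\<close>

lemma nn_integral_poisson_pmf_finite_iff:
  fixes g :: "nat \<Rightarrow> real"
  assumes "\<mu> > 0" and "\<And>k. g k \<ge> 0"
  shows "(\<integral>\<^sup>+ k. ennreal (g k) \<partial>measure_pmf (poisson_pmf \<mu>)) < \<infinity> \<longleftrightarrow>
    summable (\<lambda>k. \<mu> ^ k / fact k * exp (- \<mu>) * g k)"
proof -
  let ?t = "\<lambda>k. \<mu> ^ k / fact k * exp (- \<mu>) * g k"
  have nonneg: "?t k \<ge> 0" for k
    using assms by simp
  have "(\<integral>\<^sup>+ k. ennreal (g k) \<partial>measure_pmf (poisson_pmf \<mu>)) = (\<Sum>k. ennreal (?t k))"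
    unfolding nn_integral_measure_pmf nn_integral_count_space_nat
    by (intro suminf_cong, subst ennreal_mult'[symmetric]) (use assms in simp_all)
  moreover have "(\<Sum>k. ennreal (?t k)) < \<infinity> \<longleftrightarrow> summable ?t"
    using summable_suminf_not_top[of ?t, OF nonneg] ennreal_suminf_neq_top[of ?t, OF _ nonneg]
    unfolding infinity_ennreal_def less_top by blast
  ultimately show ?thesis by (simp only:)
qed

text \<open>Stated for a single \<open>l\<close>, so that it rewrites under both the universal and
  the existential quantifier of the two notions.\<close>

lemma subweibull_integral_poisson_iff:
  assumes "\<mu> > 0" and "poisson_rv M \<mu> X"
  shows "(\<integral>\<^sup>+ \<omega>. ennreal (exp (l powr q * \<bar>X \<omega>\<bar> powr q)) \<partial>M) < \<infinity> \<longleftrightarrow>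
    summable (\<lambda>k. \<mu> ^ k / fact k * exp (- \<mu>) * exp (l powr q * real k powr q))"
  using nn_integral_poisson_rv[OF assms(2), of "\<lambda>x. ennreal (exp (l powr q * \<bar>x\<bar> powr q))"]
    nn_integral_poisson_pmf_finite_iff[OF assms(1), of "\<lambda>k. exp (l powr q * real k powr q)"]
  by simp

text \<open>The summand 1 covers \<open>x \<le> 1\<close>, where \<open>x powr q\<close> can exceed
  \<open>x\<close>; beyond 1 the power grows with the exponent.\<close>

lemma powr_le_one_plus:
  fixes x q :: real
  assumes "x \<ge> 0" and "0 < q" and "q \<le> 1"
  shows "x powr q \<le> 1 + x"
proof (cases "x \<le> 1")
  case True
  then have "x powr q \<le> 1"
    using assms by (simp add: powr_le1)
  with assms show ?thesis by simp
next
  case False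
  then have "x powr q \<le> x powr 1"
    using assms by (intro powr_mono) auto
  with False show ?thesis by simp
qed

lemma summable_poisson_exp_powr:
  fixes \<mu> l q :: real
  assumes "\<mu> > 0" and "l > 0" and "0 < q" and "q \<le> 1"
  shows "summable (\<lambda>k. \<mu> ^ k / fact k * exp (- \<mu>) * exp (l powr q * real k powr q))"
proof (rule summable_comparison_test')
  \<comment> \<open>The majorant is the Poisson weight times \<open>exp (1 + l * real k)\<close>,
    which is a constant multiple of the exponential series at \<open>\<mu> * exp l\<close>.\<close>
  show "summable (\<lambda>k. exp (1 - \<mu>) * ((\<mu> * exp l) ^ k / fact k))"
    using summable_exp[of "\<mu> * exp l"] by (intro summable_mult) (simp add: field_simps)
  fix k :: nat
  have "l powr q * real k powr q \<le> 1 + l * real k"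
    using powr_le_one_plus[of "l * real k" q] assms by (simp add: powr_mult)
  then have "exp (l powr q * real k powr q) \<le> exp 1 * exp l ^ k"
    by (simp add: exp_of_nat_mult[symmetric] exp_add[symmetric] mult.commute)
  then have "\<mu> ^ k / fact k * exp (- \<mu>) * exp (l powr q * real k powr q)
      \<le> \<mu> ^ k / fact k * exp (- \<mu>) * (exp 1 * exp l ^ k)"
    using assms by (intro mult_left_mono) auto
  also have "\<dots> = exp (1 - \<mu>) * ((\<mu> * exp l) ^ k / fact k)"
    by (simp add: exp_diff exp_minus power_mult_distrib field_simps)
  finally show "norm (\<mu> ^ k / fact k * exp (- \<mu>) * exp (l powr q * real k powr q))
      \<le> exp (1 - \<mu>) * ((\<mu> * exp l) ^ k / fact k)"
    using assms by simp
qed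

lemma not_summable_poisson_exp_powr:
  fixes \<mu> l q :: real
  assumes "\<mu> > 0" and "l > 0" and "q > 1"
  shows "\<not> summable (\<lambda>k. \<mu> ^ k / fact k * exp (- \<mu>) * exp (l powr q * real k powr q))"
    (is "\<not> summable ?t")
proof
  assume "summable ?t"
  then have "eventually (\<lambda>k. ?t k < 1) sequentially"
    by (rule order_tendstoD(2)[OF summable_LIMSEQ_zero]) simp
  moreover have "eventually (\<lambda>k. ?t k \<ge> 1) sequentially"
  proof -
    define a c where "a = ln \<mu>" and "c = l powr q"
    have "c > 0"
      using assms by (simp add: c_def)
    \<comment> \<open>The expression is the logarithm of the \<open>k\<close>-th term with
      \<open>fact k\<close> replaced by \<open>real k ^ k\<close>; as \<open>c > 0\<close>, the
      power of exponent \<open>q > 1\<close> dominates whatever the sign of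
      \<open>a\<close>.\<close>
    with \<open>q > 1\<close> have "eventually (\<lambda>k::nat. real k * a - real k * ln (real k) - \<mu> +
        c * real k powr q \<ge> 0) sequentially"
      by real_asymp
    then show ?thesis
      \<comment> \<open>For \<open>k > 0\<close>, \<open>exp (ln (real k))\<close> is
        \<open>real k\<close>, and the denominators compared below are positive.\<close>
      using eventually_gt_at_top[of 0]
    proof eventually_elim
      case (elim k)
      have "1 \<le> exp (real k * a - real k * ln (real k) - \<mu> + c * real k powr q)"
        using elim by simp
      also have "\<dots> = \<mu> ^ k / real k ^ k * exp (- \<mu>) * exp (c * real k powr q)"
        using elim assms
        by (simp add: a_def exp_add exp_diff exp_minus exp_of_nat_mult field_simps)
      also have "\<dots> \<le> ?t k"
        unfolding c_def using assms elim fact_le_power[of k, where ?'a = real]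
        by (intro mult_right_mono divide_left_mono) auto
      finally show ?case .
    qed
  qed
  ultimately have "eventually (\<lambda>k::nat. False) sequentially"
    by eventually_elim simp
  then show False by simp
qed

theorem proposition3p2:
  fixes M :: "'a measure" and X :: "'a \<Rightarrow> real" and \<mu> :: real
  assumes "prob_space M" and "\<mu> > 0" and "poisson_rv M \<mu> X"
  shows "(\<forall>q\<in>{0<..1}. strictly_subweibull M q X) \<and> (\<forall>q>1. \<not> subweibull M q X)"
  \<comment> \<open>Divergence holds for every \<open>l > 0\<close>, which is what refuting the
    existential in \<open>subweibull\<close> requires.\<close>
  using summable_poisson_exp_powr[OF assms(2)] not_summable_poisson_exp_powr[OF assms(2)]
  unfolding strictly_subweibull_def subweibull_def
    subweibull_integral_poisson_iff[OF assms(2,3)] greaterThanAtMost_iff Ball_def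
  by blast

end
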